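(* The set $G^1$ of non-commutative formal power series with constant coefficient $1_A$, equipped with the shifted composition $(f\bullet g)(x)=g(x)\,f(xg(x))$, is a non-commutative group with unit $1_A$.
   Context: $\mathbb K$ is a field of characteristic zero and $A$ is a nonzero commutative unital $\mathbb K$-algebra. $R=A\langle\langle x_1,x_2,x_3,\dots\rangle\rangle$ is the ring of formal power series in countably many non-commuting variables $x_i$, $i\in\mathbb N=\{1,2,3,\dots\}$, with coefficients in $A$ (which commute with the variables). $\mathbb N^*$ is the set of non-empty finite words over $\mathbb N$, and $\mathbf 1$ is the empty word. An element of $R$ is an arbitrary formal sum $f(x)=\sum_{w\in\mathbb N^*\cup\{\mathbf 1\}}f_wx_w$ with $f_w\in A$, where $x_w=x_{i_1}\cdots x_{i_m}$ for $w=i_1\cdots i_m$, and $x_{\mathbf 1}=1_A$. Juxtaposition is the usual (Cauchy) product of non-commutative series. $G^1=\{f\in R: f_{\mathbf 1}=1_A\}$. For $g\in G^1$ and $f\in R$, $f(xg(x))$ is the series obtained from $f$ by substituting $x_ig(x)$ for $x_i$ for every $i$, i.e. $f(xg(x))=f_{\mathbf 1}+\sum_{i_1\cdots i_k\in\mathbb N^*}f_{i_1\cdots i_k}\,x_{i_1}g(x)\,x_{i_2}g(x)\cdots x_{i_k}g(x)$. For $f,g\in G^1$ the shifted composition is $(f\bullet g)(x):=g(x)f(xg(x))$. *)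

theory Defs
  imports Complex_Main "HOL-Library.Groups_Big_Fun" "HOL-Algebra.Group"
begin

typedef posnat = "{n :: nat. n \<ge> 1}"
  by auto

type_synonym word = "posnat list"

typedef 'a ncps = "UNIV :: (word \<Rightarrow> 'a) set"
  morphisms nc_coeff Abs_ncps
  by simp

setup_lifting type_definition_ncps

lemma ncps_eq_iff: "f = g \<longleftrightarrow> (\<forall>w. nc_coeff f w = nc_coeff g w)"
  by (metis ext nc_coeff_inject)

lemma ncps_eqI: "(\<And>w. nc_coeff f w = nc_coeff g w) \<Longrightarrow> f = g"
  by (simp add: ncps_eq_iff)

instantiation ncps :: (comm_ring_1) ring_1
begin

lift_definition zero_ncps :: "'a ncps" is "\<lambda>w. 0" .
lift_definition one_ncps :: "'a ncps" is "\<lambda>w. if w = [] then 1 else 0" .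
lift_definition plus_ncps :: "'a ncps \<Rightarrow> 'a ncps \<Rightarrow> 'a ncps" is "\<lambda>f g w. f w + g w" .
lift_definition minus_ncps :: "'a ncps \<Rightarrow> 'a ncps \<Rightarrow> 'a ncps" is "\<lambda>f g w. f w - g w" .
lift_definition uminus_ncps :: "'a ncps \<Rightarrow> 'a ncps" is "\<lambda>f w. - f w" .

text \<open>Cauchy product: the sum ranges over all factorisations of the word \<open>w\<close> into
  a prefix and a suffix.\<close>

lift_definition times_ncps :: "'a ncps \<Rightarrow> 'a ncps \<Rightarrow> 'a ncps"
  is "\<lambda>f g w. \<Sum>k\<le>length w. f (take k w) * g (drop k w)" .

instance
proof
  fix a b c :: "'a ncps"
  show "a * b * c = a * (b * c)"
  proof (rule ncps_eqI)
    fix w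
    have "nc_coeff (a * b * c) w =
      (\<Sum>k\<le>length w. \<Sum>j\<le>k. nc_coeff a (take j w) * nc_coeff b (drop j (take k w)) * nc_coeff c (drop k w))"
      by (auto simp: times_ncps.rep_eq sum_distrib_right min_def intro!: sum.cong)
    also have "\<dots> = (\<Sum>j\<le>length w. \<Sum>i\<le>length w - j.
        nc_coeff a (take j w) * nc_coeff b (drop j (take (i + j) w)) * nc_coeff c (drop (i + j) w))"
      unfolding sum.Sigma [OF finite_atMost ballI [OF finite_atMost]]
      by (rule sum.reindex_bij_witness
        [where i = "\<lambda>(j, i). (i + j, j)" and j = "\<lambda>(k, j). (j, k - j)"]) auto
    also have "\<dots> = nc_coeff (a * (b * c)) w"
      by (simp add: times_ncps.rep_eq sum_distrib_left mult.assoc drop_take add.commute)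
    finally show "nc_coeff (a * b * c) w = nc_coeff (a * (b * c)) w" .
  qed
  show "1 * a = a"
  proof (rule ncps_eqI)
    fix w
    have "nc_coeff (1 * a) w = (\<Sum>k\<in>{0}. nc_coeff a (drop k w))"
      unfolding times_ncps.rep_eq one_ncps.rep_eq
      by (rule sum.mono_neutral_cong_right) auto
    then show "nc_coeff (1 * a) w = nc_coeff a w" by simp
  qed
  show "a * 1 = a"
  proof (rule ncps_eqI)
    fix w
    have "nc_coeff (a * 1) w = (\<Sum>k\<in>{length w}. nc_coeff a (take k w))"
      unfolding times_ncps.rep_eq one_ncps.rep_eq
      by (rule sum.mono_neutral_cong_right) auto
    then show "nc_coeff (a * 1) w = nc_coeff a w" by simp
  qed
  show "(0 :: 'a ncps) \<noteq> 1"
    unfolding ncps_eq_iff by (auto simp: zero_ncps.rep_eq one_ncps.rep_eq)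
qed (auto simp: ncps_eq_iff zero_ncps.rep_eq plus_ncps.rep_eq minus_ncps.rep_eq
      uminus_ncps.rep_eq times_ncps.rep_eq algebra_simps sum.distrib)

end

lift_definition nc_var :: "posnat \<Rightarrow> 'a :: comm_ring_1 ncps"
  is "\<lambda>i w. if w = [i] then 1 else 0" .

text \<open>The monomial in \<open>f(x g(x))\<close> belonging to the word \<open>v = i\<^sub>1 \<dots> i\<^sub>k\<close> is
  \<open>x\<^bsub>i\<^sub>1\<^esub> g(x) \<dots> x\<^bsub>i\<^sub>k\<^esub> g(x)\<close>; for the empty word it is \<open>1\<close>.\<close>

definition shift_monom :: "'a :: comm_ring_1 ncps \<Rightarrow> word \<Rightarrow> 'a ncps" where
  "shift_monom g v = prod_list (map (\<lambda>i. nc_var i * g) v)"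

text \<open>The coefficients of \<open>f(x g(x))\<close>, an infinite sum over all words \<open>v\<close>. By
  \<open>finite_shift_subst\<close> below, only finitely many words contribute to each coefficient,
  so that the default value of \<open>Sum_any\<close> for infinite support plays no role.\<close>

definition shift_subst :: "'a :: comm_ring_1 ncps \<Rightarrow> 'a ncps \<Rightarrow> 'a ncps" where
  "shift_subst f g = Abs_ncps (\<lambda>w. Sum_any (\<lambda>v. nc_coeff f v * nc_coeff (shift_monom g v) w))"

definition shift_comp :: "'a :: comm_ring_1 ncps \<Rightarrow> 'a ncps \<Rightarrow> 'a ncps" where
  "shift_comp f g = g * shift_subst f g"

definition G1 :: "'a :: comm_ring_1 ncps set" where
  "G1 = {f. nc_coeff f [] = 1}"

lemma nc_coeff_var_times:
  "nc_coeff (nc_var i * g) w =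
    (case w of [] \<Rightarrow> 0 | j # u \<Rightarrow> if j = i then nc_coeff g u else 0)"
proof (cases w)
  case Nil
  then show ?thesis by (simp add: times_ncps.rep_eq nc_var.rep_eq)
next
  case (Cons j u)
  have "nc_coeff (nc_var i * g) w =
      (\<Sum>k\<in>{1}. nc_coeff (nc_var i) (take k w) * nc_coeff g (drop k w))"
    unfolding times_ncps.rep_eq nc_var.rep_eq
    by (rule sum.mono_neutral_right) (auto simp: Cons take_Cons split: nat.splits)
  then show ?thesis by (simp add: Cons nc_var.rep_eq)
qed

lemma shift_monom_nonzero_imp:
  "nc_coeff (shift_monom g v) w \<noteq> 0 \<Longrightarrow> length v \<le> length w \<and> set v \<subseteq> set w"
proof (induction v arbitrary: w)
  case Nil
  then show ?case by simp
next
  case (Cons i v)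
  have "nc_coeff (nc_var i * g * shift_monom g v) w \<noteq> 0"
    using Cons.prems by (simp add: shift_monom_def)
  then obtain k where k: "k \<le> length w"
      "nc_coeff (nc_var i * g) (take k w) * nc_coeff (shift_monom g v) (drop k w) \<noteq> 0"
    unfolding times_ncps.rep_eq [of "nc_var i * g"]
    by (metis (no_types, lifting) atMost_iff sum.neutral)
  then have 1: "nc_coeff (nc_var i * g) (take k w) \<noteq> 0"
    and 2: "nc_coeff (shift_monom g v) (drop k w) \<noteq> 0" by auto
  from 1 obtain u where u: "take k w = i # u"
    by (auto simp: nc_coeff_var_times split: list.splits if_splits)
  obtain z where z: "z = drop k w" by blast
  have w: "w = i # u @ z" by (metis append_Cons append_take_drop_id u z)
  have "length v \<le> length z" "set v \<subseteq> set z" using Cons.IH [OF 2] z by auto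
  then show ?case by (auto simp: w)
qed

lemma finite_shift_subst:
  "finite {v. nc_coeff f v * nc_coeff (shift_monom g v) w \<noteq> 0}"
proof (rule finite_subset)
  show "{v. nc_coeff f v * nc_coeff (shift_monom g v) w \<noteq> 0}
      \<subseteq> {v. set v \<subseteq> set w \<and> length v \<le> length w}"
    using shift_monom_nonzero_imp [of g _ w] by (smt (verit) Collect_mono mult_zero_right)
qed (simp add: finite_lists_length_le)

end

theory Submission
  imports Defs
begin

text \<open>
  Write \<open>D\<^sub>i f\<close> for the series with \<open>f = f\<^sub>\<one> + \<Sum>\<^sub>i x\<^sub>i D\<^sub>i f\<close>. The substitution
  \<open>S\<^sub>g f = f(x g(x))\<close> preserves the constant coefficient and satisfies
  \<open>D\<^sub>i (S\<^sub>g f) = g S\<^sub>g (D\<^sub>i f)\<close>. These two equations determine \<open>S\<^sub>g\<close>, and comparing both sides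
  of an identity through their constant coefficients and their \<open>D\<^sub>i\<close> shows that \<open>S\<^sub>g\<close> is a
  ring endomorphism with \<open>S\<^sub>h \<circ> S\<^sub>g = S\<^bsub>h S\<^sub>h(g)\<^esub>\<close>, which is associativity. A left inverse
  of \<open>g\<close> is a solution \<open>f\<close> of \<open>S\<^sub>g f = g\<^sup>-\<^sup>1\<close>; the equation \<open>S\<^sub>g f = k\<close> is solved letter by
  letter through \<open>D\<^sub>i f = S\<^sub>g\<^sup>-\<^sup>1 (g\<^sup>-\<^sup>1 D\<^sub>i k)\<close>.
\<close>

section \<open>Letter derivatives and coinduction\<close>

lift_definition nc_deriv :: "posnat \<Rightarrow> 'a :: comm_ring_1 ncps \<Rightarrow> 'a ncps"
  is "\<lambda>i f w. f (i # w)" .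

text \<open>Supplies the constant coefficient in the second term of the product rule
  \<open>nc_deriv_times\<close>.\<close>

lift_definition nc_scale :: "'a :: comm_ring_1 \<Rightarrow> 'a ncps \<Rightarrow> 'a ncps"
  is "\<lambda>c f w. c * f w" .

lemmas nc_coeff_simps [simp] =
  zero_ncps.rep_eq one_ncps.rep_eq plus_ncps.rep_eq nc_deriv.rep_eq nc_scale.rep_eq nc_var.rep_eq

lemma nc_coeff_times_Nil [simp]: "nc_coeff (f * g) [] = nc_coeff f [] * nc_coeff g []"
  by (simp add: times_ncps.rep_eq)

lemma nc_coeff_times_Cons:
  "nc_coeff (f * g) (i # w) =
    nc_coeff f [] * nc_coeff g (i # w) + nc_coeff (nc_deriv i f * g) w"
  by (simp add: times_ncps.rep_eq sum.atMost_Suc_shift del: sum.atMost_Suc)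

lemma nc_deriv_add: "nc_deriv i (f + g) = nc_deriv i f + nc_deriv i g"
  by (simp add: ncps_eq_iff)

lemma nc_deriv_zero [simp]: "nc_deriv i 0 = 0"
  by (simp add: ncps_eq_iff)

lemma nc_deriv_one [simp]: "nc_deriv i 1 = 0"
  by (simp add: ncps_eq_iff)

lemma nc_deriv_var: "nc_deriv i (nc_var j) = (if i = j then 1 else 0)"
  by (simp add: ncps_eq_iff)

lemma nc_deriv_scale: "nc_deriv i (nc_scale c f) = nc_scale c (nc_deriv i f)"
  by (simp add: ncps_eq_iff)

lemma nc_deriv_times:
  "nc_deriv i (f * g) = nc_deriv i f * g + nc_scale (nc_coeff f []) (nc_deriv i g)"
  by (simp add: ncps_eq_iff nc_coeff_times_Cons add.commute)

lemma times_nc_scale: "f * nc_scale c g = nc_scale c (f * g)"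
  by (simp add: ncps_eq_iff times_ncps.rep_eq sum_distrib_left mult.left_commute)

lemma nc_coeff_times_cong:
  assumes "\<And>v. length v \<le> length w \<Longrightarrow> nc_coeff a v = nc_coeff b v"
  shows "nc_coeff (c * a) w = nc_coeff (c * b) w"
  by (simp add: times_ncps.rep_eq assms)

text \<open>Derivatives need agree only up to a common left factor \<open>c\<close>: the coefficient
  of \<open>c * a'\<close> at \<open>u\<close> involves \<open>a'\<close> only at suffixes of
  \<open>u\<close>, all shorter than \<open>i # u\<close>, so induction on the length
  applies.\<close>

lemma ncps_coinduct_times [consumes 1, case_names Nil deriv]:
  assumes "R a b"
    and Nil: "\<And>a b. R a b \<Longrightarrow> nc_coeff a [] = nc_coeff b []"
    and deriv: "\<And>a b i. R a b \<Longrightarrow>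
      \<exists>c a' b'. nc_deriv i a = c * a' \<and> nc_deriv i b = c * b' \<and> R a' b'"
  shows "a = b"
proof (rule ncps_eqI)
  fix w
  show "nc_coeff a w = nc_coeff b w"
    using \<open>R a b\<close>
  proof (induction w arbitrary: a b rule: length_induct)
    case (1 w)
    show ?case
    proof (cases w)
      case Nil
      with assms(2) 1(2) show ?thesis by simp
    next
      case (Cons i u)
      obtain c a' b' where *: "nc_deriv i a = c * a'" "nc_deriv i b = c * b'" "R a' b'"
        using deriv [OF 1(2)] by blast
      have "nc_coeff (c * a') u = nc_coeff (c * b') u"
        by (rule nc_coeff_times_cong) (use 1(1) Cons *(3) in auto)
      then show ?thesis
        by (metis * Cons nc_deriv.rep_eq)
    qed
  qed
qed

section \<open>Substitution\<close>

lemma nc_coeff_shift_subst_eq_sum: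
  assumes "finite V" "\<And>v. v \<notin> V \<Longrightarrow> nc_coeff (shift_monom g v) w = 0"
  shows "nc_coeff (shift_subst f g) w =
    (\<Sum>v\<in>V. nc_coeff f v * nc_coeff (shift_monom g v) w)"
  unfolding shift_subst_def Abs_ncps_inverse [OF UNIV_I]
  by (rule Sum_any.expand_superset) (use assms in \<open>auto, metis mult_zero_right\<close>)

lemma shift_monom_Nil [simp]: "shift_monom g [] = 1"
  by (simp add: shift_monom_def)

lemma nc_coeff_shift_monom_Cons_Nil [simp]: "nc_coeff (shift_monom g (j # v)) [] = 0"
  by (simp add: shift_monom_def)

lemma nc_coeff_shift_monom_Cons_Cons:
  "nc_coeff (shift_monom g (j # v)) (i # w) =
    (if i = j then nc_coeff (g * shift_monom g v) w else 0)"
  by (simp add: shift_monom_def mult.assoc nc_coeff_var_times)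

lemma nc_coeff_shift_subst_Nil [simp]: "nc_coeff (shift_subst f g) [] = nc_coeff f []"
proof -
  have "nc_coeff (shift_monom g v) [] = 0" if "v \<notin> {[]}" for v
    using that by (cases v) auto
  then have "nc_coeff (shift_subst f g) [] =
      (\<Sum>v\<in>{[]}. nc_coeff f v * nc_coeff (shift_monom g v) [])"
    by (intro nc_coeff_shift_subst_eq_sum) simp_all
  then show ?thesis
    by simp
qed

text \<open>Only words \<open>v\<close> starting with \<open>i\<close> reach a coefficient at
  \<open>i # w\<close>, and stripping that letter leaves \<open>g * shift_monom g u\<close>, where
  \<open>u\<close> is the tail of \<open>v\<close>.\<close>

lemma nc_deriv_shift_subst:
  "nc_deriv i (shift_subst f g) = g * shift_subst (nc_deriv i f) g"
proof (rule ncps_eqI)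
  fix w
  \<comment> \<open>One finite set covers the supports for all suffixes of \<open>w\<close> at once,
    so the sums over \<open>v\<close> and over \<open>k\<close> can be swapped.\<close>
  define V where "V = {v :: word. set v \<subseteq> set w \<and> length v \<le> length w}"
  have fin: "finite V"
    by (simp add: V_def finite_lists_length_le)
  have V: "nc_coeff (shift_monom g v) (drop k w) = 0" if "v \<notin> V" for v k
    using that shift_monom_nonzero_imp [of g v "drop k w"] set_drop_subset [of k w]
    by (force simp: V_def)
  have "nc_coeff (shift_monom g v) (i # w) = 0" if "v \<notin> (#) i ` V" for v
  proof (cases v)
    case (Cons j u)
    then have "i = j \<Longrightarrow> u \<notin> V" using that by blast
    then show ?thesis
      by (auto simp: Cons nc_coeff_shift_monom_Cons_Cons times_ncps.rep_eq V)
  qed simp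
  then have "nc_coeff (nc_deriv i (shift_subst f g)) w =
      (\<Sum>v\<in>(#) i ` V. nc_coeff f v * nc_coeff (shift_monom g v) (i # w))"
    using nc_coeff_shift_subst_eq_sum [of "(#) i ` V" g "i # w" f] fin by simp
  also have "\<dots> = (\<Sum>v\<in>V. nc_coeff f (i # v) * nc_coeff (g * shift_monom g v) w)"
    by (simp add: sum.reindex nc_coeff_shift_monom_Cons_Cons)
  also have "\<dots> = (\<Sum>k\<le>length w. nc_coeff g (take k w) *
      (\<Sum>v\<in>V. nc_coeff f (i # v) * nc_coeff (shift_monom g v) (drop k w)))"
    unfolding times_ncps.rep_eq sum_distrib_left
    by (subst sum.swap) (simp add: mult.left_commute)
  also have "\<dots> = nc_coeff (g * shift_subst (nc_deriv i f) g) w"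
    by (simp add: times_ncps.rep_eq nc_coeff_shift_subst_eq_sum [OF fin V])
  finally show "nc_coeff (nc_deriv i (shift_subst f g)) w =
      nc_coeff (g * shift_subst (nc_deriv i f) g) w" .
qed

text \<open>Coinduction with \<open>f\<close> and \<open>h\<close> quantified inside
  \<open>R\<close>, because a letter derivative replaces them by their derivatives while
  \<open>g\<close> stays fixed.\<close>

lemma shift_subst_add: "shift_subst (f + h) g = shift_subst f g + shift_subst h g"
proof -
  define R where "R a b \<longleftrightarrow>
    (\<exists>f h. a = shift_subst (f + h) g \<and> b = shift_subst f g + shift_subst h g)" for a b
  have "R (shift_subst (f + h) g) (shift_subst f g + shift_subst h g)"
    by (auto simp: R_def)
  then show ?thesis
  proof (cases rule: ncps_coinduct_times [of R])
    case (deriv a b i)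
    then obtain f h where "a = shift_subst (f + h) g" "b = shift_subst f g + shift_subst h g"
      by (auto simp: R_def)
    then have "nc_deriv i a = g * shift_subst (nc_deriv i f + nc_deriv i h) g"
      "nc_deriv i b = g * (shift_subst (nc_deriv i f) g + shift_subst (nc_deriv i h) g)"
      by (simp_all add: nc_deriv_shift_subst nc_deriv_add distrib_left)
    then show ?case unfolding R_def by blast
  qed (auto simp: R_def)
qed

lemma shift_subst_scale: "shift_subst (nc_scale c f) g = nc_scale c (shift_subst f g)"
proof -
  define R where "R a b \<longleftrightarrow>
    (\<exists>f. a = shift_subst (nc_scale c f) g \<and> b = nc_scale c (shift_subst f g))" for a b
  have "R (shift_subst (nc_scale c f) g) (nc_scale c (shift_subst f g))"
    by (auto simp: R_def)
  then show ?thesis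
  proof (cases rule: ncps_coinduct_times [of R])
    case (deriv a b i)
    then obtain f where "a = shift_subst (nc_scale c f) g" "b = nc_scale c (shift_subst f g)"
      by (auto simp: R_def)
    then have "nc_deriv i a = g * shift_subst (nc_scale c (nc_deriv i f)) g"
      "nc_deriv i b = g * nc_scale c (shift_subst (nc_deriv i f) g)"
      by (simp_all add: nc_deriv_shift_subst nc_deriv_scale times_nc_scale)
    then show ?case unfolding R_def by blast
  qed (auto simp: R_def)
qed

lemma shift_subst_zero [simp]: "shift_subst 0 g = 0"
  using shift_subst_add [of 0 0 g] by simp

lemma shift_subst_one [simp]: "shift_subst 1 g = 1"
proof (rule ncps_eqI)
  fix w
  show "nc_coeff (shift_subst 1 g) w = nc_coeff 1 w"
  proof (cases w)
    case (Cons i u)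
    have "nc_coeff (shift_subst 1 g) w = nc_coeff (nc_deriv i (shift_subst 1 g)) u"
      by (simp add: Cons)
    then show ?thesis
      by (simp add: Cons nc_deriv_shift_subst del: nc_deriv.rep_eq)
  qed simp
qed

lemma shift_subst_var: "shift_subst (nc_var j) g = nc_var j * g"
proof (rule ncps_eqI)
  fix w
  show "nc_coeff (shift_subst (nc_var j) g) w = nc_coeff (nc_var j * g) w"
  proof (cases w)
    case (Cons i u)
    have "nc_coeff (shift_subst (nc_var j) g) w = nc_coeff (nc_deriv i (shift_subst (nc_var j) g)) u"
      by (simp add: Cons)
    then show ?thesis
      by (simp add: Cons nc_deriv_shift_subst nc_deriv_var nc_coeff_var_times del: nc_deriv.rep_eq)
  qed simp
qed

text \<open>The statement is generalised by the summand \<open>k\<close>, which absorbs the second term of the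
  product rule \<open>nc_deriv_times\<close>.\<close>

lemma shift_subst_times_add:
  "shift_subst (f * h + k) g = shift_subst f g * shift_subst h g + shift_subst k g"
proof -
  define R where "R a b \<longleftrightarrow> (\<exists>f h k. a = shift_subst (f * h + k) g \<and>
    b = shift_subst f g * shift_subst h g + shift_subst k g)" for a b
  have "R (shift_subst (f * h + k) g) (shift_subst f g * shift_subst h g + shift_subst k g)"
    by (auto simp: R_def)
  then show ?thesis
  proof (cases rule: ncps_coinduct_times [of R])
    case (deriv a b i)
    then obtain f h k where ab: "a = shift_subst (f * h + k) g"
      "b = shift_subst f g * shift_subst h g + shift_subst k g"
      by (auto simp: R_def)
    define k' where "k' = nc_scale (nc_coeff f []) (nc_deriv i h) + nc_deriv i k"
    have "nc_deriv i a = g * shift_subst (nc_deriv i f * h + k') g"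
      by (simp add: ab k'_def nc_deriv_shift_subst nc_deriv_add nc_deriv_times add.assoc)
    moreover have "nc_deriv i b =
        g * (shift_subst (nc_deriv i f) g * shift_subst h g + shift_subst k' g)"
      by (simp add: ab k'_def nc_deriv_shift_subst nc_deriv_add nc_deriv_times
          shift_subst_add shift_subst_scale times_nc_scale distrib_left mult.assoc add.assoc)
    ultimately show ?case unfolding R_def by blast
  qed (auto simp: R_def)
qed

lemma shift_subst_times: "shift_subst (f * h) g = shift_subst f g * shift_subst h g"
  using shift_subst_times_add [of f h 0 g] by simp

text \<open>By multiplicativity, differentiating the left side gives
  \<open>h * shift_subst g h\<close> times an expression of the same form; this factor is
  \<open>shift_comp g h\<close>, as on the right side.\<close>

lemma shift_subst_shift_subst:
  "shift_subst (shift_subst f g) h = shift_subst f (shift_comp g h)"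
proof -
  define R where "R a b \<longleftrightarrow>
    (\<exists>f. a = shift_subst (shift_subst f g) h \<and> b = shift_subst f (shift_comp g h))" for a b
  have "R (shift_subst (shift_subst f g) h) (shift_subst f (shift_comp g h))"
    by (auto simp: R_def)
  then show ?thesis
  proof (cases rule: ncps_coinduct_times [of R])
    case (deriv a b i)
    then obtain f where
      "a = shift_subst (shift_subst f g) h" "b = shift_subst f (shift_comp g h)"
      by (auto simp: R_def)
    then have "nc_deriv i a = shift_comp g h * shift_subst (shift_subst (nc_deriv i f) g) h"
      "nc_deriv i b = shift_comp g h * shift_subst (nc_deriv i f) (shift_comp g h)"
      by (simp_all add: nc_deriv_shift_subst shift_subst_times shift_comp_def mult.assoc)
    then show ?case unfolding R_def by blast
  qed (auto simp: R_def)
qed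

section \<open>Inverses\<close>

text \<open>Solves \<open>nc_deriv i g * r + nc_deriv i r = 0\<close> for \<open>r\<close>, which is
  \<open>g * r = 1\<close> differentiated when \<open>g\<close> has constant coefficient 1.\<close>

function nc_inverse_coeff :: "'a :: comm_ring_1 ncps \<Rightarrow> word \<Rightarrow> 'a" where
  "nc_inverse_coeff g [] = 1"
| "nc_inverse_coeff g (i # w) =
    - (\<Sum>k\<le>length w. nc_coeff g (i # take k w) * nc_inverse_coeff g (drop k w))"
  by pat_completeness auto
termination
  by (relation "measure (length \<circ> snd)") auto

lemma nc_right_inverse_exists:
  assumes "nc_coeff g [] = 1"
  shows "\<exists>r. g * r = 1"
proof
  let ?r = "Abs_ncps (nc_inverse_coeff g)"
  have r: "nc_coeff ?r = nc_inverse_coeff g"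
    by (simp add: Abs_ncps_inverse)
  show "g * ?r = 1"
  proof (rule ncps_eqI)
    fix w
    show "nc_coeff (g * ?r) w = nc_coeff 1 w"
    proof (cases w)
      case (Cons i u)
      have "nc_coeff (nc_deriv i g * ?r) u = - nc_inverse_coeff g w"
        by (simp add: Cons r times_ncps.rep_eq)
      then show ?thesis
        by (simp add: Cons assms r nc_coeff_times_Cons)
    qed (simp add: assms r)
  qed
qed

text \<open>If \<open>g * r = 1\<close>, then \<open>shift_subst_preimage_coeff r k\<close> lists the coefficients of the
  series \<open>f\<close> with \<open>shift_subst f g = k\<close>.\<close>

fun shift_subst_preimage_coeff :: "'a :: comm_ring_1 ncps \<Rightarrow> 'a ncps \<Rightarrow> word \<Rightarrow> 'a" where
  "shift_subst_preimage_coeff r k [] = nc_coeff k []"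
| "shift_subst_preimage_coeff r k (i # w) = shift_subst_preimage_coeff r (r * nc_deriv i k) w"

lemma shift_subst_surj:
  assumes "g * r = 1"
  shows "\<exists>f. shift_subst f g = k"
proof
  define T where "T k = Abs_ncps (shift_subst_preimage_coeff r k)" for k
  have T: "nc_coeff (T k) = shift_subst_preimage_coeff r k" for k
    by (simp add: T_def Abs_ncps_inverse)
  have deriv_T: "nc_deriv i (T k) = T (r * nc_deriv i k)" for i k
    by (simp add: ncps_eq_iff T)
  define R where "R a b \<longleftrightarrow> a = shift_subst (T b) g" for a b
  have "R (shift_subst (T k) g) k"
    by (simp add: R_def)
  then show "shift_subst (T k) g = k"
  proof (cases rule: ncps_coinduct_times [of R])
    case (deriv a b i)
    then have "nc_deriv i a = g * shift_subst (T (r * nc_deriv i b)) g"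
      by (simp add: R_def nc_deriv_shift_subst deriv_T)
    \<comment> \<open>Inserting \<open>g * r = 1\<close> creates the common left factor
      \<open>g\<close> that the coinduction asks for.\<close>
    moreover have "nc_deriv i b = g * (r * nc_deriv i b)"
      by (simp add: assms flip: mult.assoc)
    ultimately show ?case unfolding R_def by blast
  qed (auto simp: R_def T)
qed

section \<open>The group\<close>

lemma shift_comp_in_G1: "f \<in> G1 \<Longrightarrow> g \<in> G1 \<Longrightarrow> shift_comp f g \<in> G1"
  by (simp add: G1_def shift_comp_def)

lemma shift_comp_assoc: "shift_comp (shift_comp f g) h = shift_comp f (shift_comp g h)"
proof -
  have "shift_comp (shift_comp f g) h = h * shift_subst (g * shift_subst f g) h"
    by (simp add: shift_comp_def)
  also have "\<dots> = shift_comp g h * shift_subst f (shift_comp g h)"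
    by (simp add: shift_subst_times shift_subst_shift_subst mult.assoc
        flip: shift_comp_def [of g h])
       (simp add: shift_comp_def mult.assoc)
  finally show ?thesis
    by (simp add: shift_comp_def)
qed

lemma shift_comp_one_left: "shift_comp 1 g = g"
  by (simp add: shift_comp_def)

lemma shift_comp_left_inverse_exists:
  assumes "g \<in> G1"
  shows "\<exists>f\<in>G1. shift_comp f g = 1"
proof -
  have g: "nc_coeff g [] = 1"
    using assms by (simp add: G1_def)
  obtain r where r: "g * r = 1"
    using nc_right_inverse_exists [OF g] by blast
  obtain f where f: "shift_subst f g = r"
    using shift_subst_surj [OF r] by blast
  \<comment> \<open>Substitution keeps the constant coefficient, so \<open>f\<close> and
    \<open>r\<close> share theirs.\<close>
  have "nc_coeff f [] = nc_coeff (g * r) []"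
    by (simp add: g flip: f)
  then have "f \<in> G1"
    by (simp add: G1_def r)
  moreover have "shift_comp f g = 1"
    by (simp add: shift_comp_def f r)
  ultimately show ?thesis ..
qed

text \<open>\<open>groupI\<close> asks only for a left unit and left inverses.\<close>

lemma group_shift_comp: "group \<lparr>carrier = G1, mult = shift_comp, one = 1\<rparr>"
  by (rule groupI)
    (use shift_comp_left_inverse_exists in
      \<open>auto simp: shift_comp_in_G1 shift_comp_assoc shift_comp_one_left, auto simp: G1_def\<close>)

lemma shift_comp_one_plus_var:
  "shift_comp (1 + nc_var i) g = g * (1 + nc_var i * g)"
  by (simp add: shift_comp_def shift_subst_add shift_subst_var)

text \<open>The words of length at most two do not distinguish the two products.\<close>

lemma shift_comp_var_not_commute:
  assumes "i \<noteq> j"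
  shows "shift_comp (1 + nc_var i :: 'a :: comm_ring_1 ncps) (1 + nc_var j) \<noteq>
    shift_comp (1 + nc_var j) (1 + nc_var i)"
proof
  assume eq: "shift_comp (1 + nc_var i :: 'a ncps) (1 + nc_var j) =
    shift_comp (1 + nc_var j) (1 + nc_var i)"
  \<comment> \<open>Expanded so that every product has a variable on its left, as
    \<open>nc_coeff_var_times\<close> requires.\<close>
  have coeff: "nc_coeff (shift_comp (1 + nc_var a :: 'a ncps) (1 + nc_var b)) w =
      nc_coeff (1 + nc_var a * (1 + nc_var b) + nc_var b * (1 + nc_var a * (1 + nc_var b))) w"
    for a b w
    by (simp only: shift_comp_one_plus_var distrib_right [of 1] mult_1_left)
  \<comment> \<open>With \<open>g = 1 + nc_var j\<close> the letter \<open>j\<close> can come from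
    both copies of \<open>g\<close> around \<open>i\<close>; in the opposite order \<open>j\<close>
    occurs at most once in each monomial.\<close>
  have "nc_coeff (shift_comp (1 + nc_var i :: 'a ncps) (1 + nc_var j)) [j, i, j] = 1"
    unfolding coeff using assms
    by (simp add: nc_coeff_var_times)
  moreover have "nc_coeff (shift_comp (1 + nc_var j :: 'a ncps) (1 + nc_var i)) [j, i, j] = 0"
    unfolding coeff using assms
    by (simp add: nc_coeff_var_times)
  ultimately show False
    by (simp add: eq)
qed

lemma posnat_exists_distinct: "\<exists>i j :: posnat. i \<noteq> j"
proof (intro exI)
  show "Abs_posnat 1 \<noteq> Abs_posnat 2"
    by (simp add: Abs_posnat_inject)
qed

theorem proposition2p4:
  fixes scale :: "'k :: field_char_0 \<Rightarrow> 'a :: comm_ring_1 \<Rightarrow> 'a"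
  assumes "vector_space scale"
    and "\<And>c a b. scale c (a * b) = scale c a * b"
  shows "group \<lparr>carrier = (G1 :: 'a ncps set), mult = shift_comp, one = 1\<rparr> \<and>
    (\<exists>f \<in> (G1 :: 'a ncps set). \<exists>g \<in> G1. shift_comp f g \<noteq> shift_comp g f)"
proof
  obtain i j :: posnat where "i \<noteq> j"
    using posnat_exists_distinct by blast
  moreover have "1 + nc_var i \<in> (G1 :: 'a ncps set)" for i
    by (simp add: G1_def)
  ultimately show "\<exists>f \<in> (G1 :: 'a ncps set). \<exists>g \<in> G1. shift_comp f g \<noteq> shift_comp g f"
    using shift_comp_var_not_commute by blast
qed (rule group_shift_comp)

end
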